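(* Let $a^*,b^*\in\mathbb{R}^2$ (the centroids of two classes), and let $\rho_{a^*}$ and $\rho_{b^*}$ be the associated density patterns, with Pauli components $(r_{a^*_1},r_{a^*_2},r_{a^*_3})$ and $(r_{b^*_1},r_{b^*_2},r_{b^*_3})$, respectively. Set $$\tilde K=\sqrt{\frac{1-r_{a^*_3}}{1-r_{b^*_3}}},\qquad \vec F(r_{a^*},r_{b^*})=\bigl(r_{a^*_1}-\tilde K^2 r_{b^*_1},\; r_{a^*_2}-\tilde K^2 r_{b^*_2},\; r_{a^*_3}-\tilde K^2 r_{b^*_3}\bigr).$$ Then the quantum discriminant function, i.e. the equation characterizing the density patterns equidistant from $\rho_{a^*}$ and $\rho_{b^*}$ in normalized trace distance, is $$f_{\mathrm{QDF}}(r_1,r_2,r_3)=\vec F(r_{a^*},r_{b^*})^T\cdot\vec r+\tilde K^2-1=0,\qquad \vec r=(r_1,r_2,r_3).$$ That is, for every pattern $c\in\mathbb{R}^2$ with density pattern $\rho_c$ having Pauli components $(r_1,r_2,r_3)$, one has $\overline{d}_{\mathrm{tr}}(\rho_c,\rho_{a^*})=\overline{d}_{\mathrm{tr}}(\rho_c,\rho_{b^*})$ if and only if $f_{\mathrm{QDF}}(r_1,r_2,r_3)=0$.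
   Context: A (two-feature) pattern is a point $\mathbf{x}=(x,y)\in\mathbb{R}^2$. Its density pattern is the $2\times 2$ complex matrix $$\rho_{\mathbf{x}}=\frac12\begin{pmatrix}1+r_3 & r_1-ir_2\\ r_1+ir_2 & 1-r_3\end{pmatrix}=\frac{1}{x^2+y^2+1}\begin{pmatrix}x^2+y^2 & x-iy\\ x+iy & 1\end{pmatrix},$$ where $$r_1=\frac{2x}{x^2+y^2+1},\quad r_2=\frac{2y}{x^2+y^2+1},\quad r_3=\frac{x^2+y^2-1}{x^2+y^2+1}$$ are called the Pauli components of $\rho_{\mathbf{x}}$ (i.e. $(r_1,r_2,r_3)$ is the image of $(x,y)$ under inverse stereographic projection from the north pole of the unit sphere). The trace distance is $d_{\mathrm{tr}}(\rho_a,\rho_b)=\frac12\sum_i|\lambda_i|$, where the $\lambda_i$ are the eigenvalues of $\rho_a-\rho_b$ (counted with multiplicity). The normalized trace distance between two density patterns $\rho_a,\rho_b$ is $$\overline{d}_{\mathrm{tr}}(\rho_a,\rho_b)=K_{a,b}\,d_{\mathrm{tr}}(\rho_a,\rho_b),\qquad K_{a,b}=\frac{2}{\sqrt{(1-r_{a_3})(1-r_{b_3})}},$$ where $r_{a_3}$ and $r_{b_3}$ are the third Pauli components of $\rho_a$ and $\rho_b$, respectively. *)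

theory Defs
  imports
    "HOL-Analysis.Euclidean_Space"
    "Jordan_Normal_Form.Char_Poly"
begin

definition inv_stereographic :: "real \<times> real \<Rightarrow> real \<times> real \<times> real" where
  "inv_stereographic = (\<lambda>(x, y).
     (2 * x / (x\<^sup>2 + y\<^sup>2 + 1), 2 * y / (x\<^sup>2 + y\<^sup>2 + 1), (x\<^sup>2 + y\<^sup>2 - 1) / (x\<^sup>2 + y\<^sup>2 + 1)))"

definition pauli_matrix :: "real \<times> real \<times> real \<Rightarrow> complex mat" where
  "pauli_matrix = (\<lambda>(r1, r2, r3). (1 / 2) \<cdot>\<^sub>m mat_of_rows_list 2
     [[1 + of_real r3, of_real r1 - \<i> * of_real r2],
      [of_real r1 + \<i> * of_real r2, 1 - of_real r3]])"

definition density_pattern :: "real \<times> real \<Rightarrow> complex mat" where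
  "density_pattern p = pauli_matrix (inv_stereographic p)"

(* Meaningful for matrices in the range of pauli_matrix, where the triple is unique. *)
definition pauli_components :: "complex mat \<Rightarrow> real \<times> real \<times> real" where
  "pauli_components \<rho> = (THE r. \<rho> = pauli_matrix r)"

abbreviation pauli3 :: "complex mat \<Rightarrow> real" where
  "pauli3 \<rho> \<equiv> snd (snd (pauli_components \<rho>))"

(* The multiplicity of an eigenvalue is the algebraic one. *)
definition trace_dist :: "complex mat \<Rightarrow> complex mat \<Rightarrow> real" where
  "trace_dist \<rho> \<sigma> =
     (1 / 2) * (\<Sum>l | eigenvalue (\<rho> - \<sigma>) l. real (order l (char_poly (\<rho> - \<sigma>))) * cmod l)"

definition normalized_trace_dist :: "complex mat \<Rightarrow> complex mat \<Rightarrow> real" where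
  "normalized_trace_dist \<rho> \<sigma> =
     2 / sqrt ((1 - pauli3 \<rho>) * (1 - pauli3 \<sigma>)) * trace_dist \<rho> \<sigma>"

definition K_tilde :: "complex mat \<Rightarrow> complex mat \<Rightarrow> real" where
  "K_tilde \<rho>a \<rho>b = sqrt ((1 - pauli3 \<rho>a) / (1 - pauli3 \<rho>b))"

definition F_vec :: "complex mat \<Rightarrow> complex mat \<Rightarrow> real \<times> real \<times> real" where
  "F_vec \<rho>a \<rho>b =
     (case (pauli_components \<rho>a, pauli_components \<rho>b) of ((a1, a2, a3), (b1, b2, b3)) \<Rightarrow>
       (a1 - (K_tilde \<rho>a \<rho>b)\<^sup>2 * b1, a2 - (K_tilde \<rho>a \<rho>b)\<^sup>2 * b2, a3 - (K_tilde \<rho>a \<rho>b)\<^sup>2 * b3))"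

definition f_QDF :: "complex mat \<Rightarrow> complex mat \<Rightarrow> real \<times> real \<times> real \<Rightarrow> real" where
  "f_QDF \<rho>a \<rho>b r = inner (F_vec \<rho>a \<rho>b) r + (K_tilde \<rho>a \<rho>b)\<^sup>2 - 1"

lemma inj_pauli_matrix: "inj pauli_matrix"
proof (rule injI)
  fix r s :: "real \<times> real \<times> real"
  assume eq: "pauli_matrix r = pauli_matrix s"
  obtain r1 r2 r3 s1 s2 s3 where rs: "r = (r1, r2, r3)" "s = (s1, s2, s3)"
    by (metis surj_pair)
  have "pauli_matrix r $$ (1, 0) = pauli_matrix s $$ (1, 0)"
    and "pauli_matrix r $$ (0, 0) = pauli_matrix s $$ (0, 0)"
    by (simp_all add: eq)
  then show "r = s"
    by (simp add: rs pauli_matrix_def mat_of_rows_list_def complex_eq_iff)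
qed

lemma pauli_components_pauli_matrix [simp]: "pauli_components (pauli_matrix r) = r"
  unfolding pauli_components_def using inj_pauli_matrix by (auto dest: injD)

lemma pauli_components_density_pattern [simp]:
  "pauli_components (density_pattern p) = inv_stereographic p"
  by (simp add: density_pattern_def)

lemma density_pattern_explicit:
  "density_pattern (x, y) = of_real (1 / (x\<^sup>2 + y\<^sup>2 + 1)) \<cdot>\<^sub>m mat_of_rows_list 2
     [[of_real (x\<^sup>2 + y\<^sup>2), of_real x - \<i> * of_real y],
      [of_real x + \<i> * of_real y, 1]]"
proof -
  define d where "d = x\<^sup>2 + y\<^sup>2 + 1"
  have "d > 0"
    unfolding d_def by (simp add: add_nonneg_pos)
  have xy: "x\<^sup>2 + y\<^sup>2 = d - 1"
    by (simp add: d_def)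
  have r: "inv_stereographic (x, y) = (2 * x / d, 2 * y / d, (d - 2) / d)"
    by (simp add: inv_stereographic_def d_def)
  show ?thesis
    unfolding density_pattern_def r d_def[symmetric] xy
    by (rule eq_matI)
       (use \<open>d > 0\<close> in \<open>auto simp: pauli_matrix_def mat_of_rows_list_def less_Suc_eq numeral_2_eq_2 field_simps\<close>)
qed

end

(* Inverse stereographic projection lands on the unit sphere, and the difference of two Pauli
   matrices is traceless with determinant -|r - s|^2 / 4, so its eigenvalues are +-|r - s| / 2.
   Hence the trace distance is half the chordal distance, and equidistance from a and b becomes
   affine in r after squaring, because |r - s|^2 = 2 (1 - r . s) for unit vectors. *)
theory Submission
  imports Defs
begin

text \<open>Stated over a commutative ring, not just a field, because it gets applied to
  \<open>char_poly_matrix A\<close>, whose entries are polynomials.\<close>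

lemma det_2x2:
  fixes A :: "'a::comm_ring_1 mat"
  assumes "A \<in> carrier_mat 2 2"
  shows "det A = A $$ (0, 0) * A $$ (1, 1) - A $$ (0, 1) * A $$ (1, 0)"
proof -
  have [simp]: "dim_row A = 2" "dim_col A = 2"
    using assms by auto
  have "det A = (\<Sum>i<2. A $$ (i, 0) * cofactor A i 0)"
    by (rule laplace_expansion_column[OF assms]) simp
  then show ?thesis
    by (simp add: cofactor_def mat_delete_def det_single numeral_2_eq_2 algebra_simps)
qed

lemma char_poly_2x2:
  fixes A :: "'a::comm_ring_1 mat"
  assumes "A \<in> carrier_mat 2 2"
  shows "char_poly A =
    [:A $$ (0, 0) * A $$ (1, 1) - A $$ (0, 1) * A $$ (1, 0), - (A $$ (0, 0) + A $$ (1, 1)), 1:]"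
proof -
  have "char_poly_matrix A \<in> carrier_mat 2 2"
    using assms by simp
  then show ?thesis
    using assms unfolding char_poly_def
    by (subst det_2x2) (auto simp: char_poly_matrix_def algebra_simps)
qed

text \<open>The sum ranges over distinct roots, so a double root \<open>x = y\<close> is indexed
  once but has order 2. Weighting by \<open>order\<close> thus gives the same value in both cases.
  This evaluates the eigenvalue sum in \<open>trace_dist\<close>.\<close>

lemma sum_order_linear_factors:
  fixes x y :: "'a::field" and f :: "'a \<Rightarrow> real"
  defines "p \<equiv> [:-x, 1:] * [:-y, 1:]"
  shows "(\<Sum>l | poly p l = 0. real (order l p) * f l) = f x + f y"
proof -
  have lin: "order l [:-z, 1:] = (if l = z then 1 else 0)" for l z :: 'a
    using order_power_n_n[of z 1] by (auto simp: order_0I)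
  have ord: "order l p = (if l = x then 1 else 0) + (if l = y then 1 else 0)" for l
    unfolding p_def by (subst order_mult) (auto simp: lin)
  have roots: "{l. poly p l = 0} = {x, y}"
    unfolding p_def poly_mult by auto
  show ?thesis
    unfolding roots by (cases "x = y") (auto simp: ord)
qed

lemma trace_dist_pauli_matrix:
  "trace_dist (pauli_matrix r) (pauli_matrix s) = norm (r - s) / 2"
proof -
  obtain d1 d2 d3 where d: "r - s = (d1, d2, d3)"
    by (metis surj_pair)
  define A where "A = pauli_matrix r - pauli_matrix s"
  define m where "m = complex_of_real (norm (r - s) / 2)"
  have n: "(norm (r - s))\<^sup>2 = d1\<^sup>2 + d2\<^sup>2 + d3\<^sup>2"
    by (simp add: d norm_Pair)
  have A: "A \<in> carrier_mat 2 2"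
    by (auto simp: A_def pauli_matrix_def mat_of_rows_list_def split: prod.splits)
  have entries: "A $$ (0, 0) = d3 / 2" "A $$ (1, 1) = - d3 / 2"
    "A $$ (0, 1) = (d1 - \<i> * d2) / 2" "A $$ (1, 0) = (d1 + \<i> * d2) / 2"
    using d by (auto simp: A_def pauli_matrix_def mat_of_rows_list_def field_simps split: prod.splits)
  have "m * m = of_real ((d1\<^sup>2 + d2\<^sup>2 + d3\<^sup>2) / 4)"
    unfolding n[symmetric] by (simp add: m_def power2_eq_square)
  \<comment> \<open>The trace vanishes, so there is no linear term, and the constant term is
    \<open>- m * m\<close>. The factors keep the shape \<open>[:- (-m), 1:]\<close> to fit
    \<open>sum_order_linear_factors\<close>; \<open>r = s\<close> is the double root
    \<open>m = 0\<close>.\<close>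
  then have cp: "char_poly A = [:-m, 1:] * [:- (-m), 1:]"
    unfolding char_poly_2x2[OF A] entries by (simp add: power2_eq_square field_simps)
  have "trace_dist (pauli_matrix r) (pauli_matrix s) =
    1 / 2 * (\<Sum>l | poly (char_poly A) l = 0. real (order l (char_poly A)) * cmod l)"
    by (simp add: trace_dist_def eigenvalue_root_char_poly[OF A] flip: A_def)
  also have "\<dots> = cmod m"
    unfolding cp sum_order_linear_factors by simp
  finally show ?thesis
    by (simp add: m_def)
qed

text \<open>With \<open>s\<close> standing for the sum of the two squares, clearing denominators
  leaves 4 s + (s - 1)^2 = (s + 1)^2.\<close>

lemma norm_inv_stereographic: "norm (inv_stereographic p) = 1"
proof (cases p)
  case (Pair x y)
  have "x\<^sup>2 + y\<^sup>2 + 1 > 0"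
    by (simp add: add_nonneg_pos)
  then have "(2 * x / (x\<^sup>2 + y\<^sup>2 + 1))\<^sup>2 + ((2 * y / (x\<^sup>2 + y\<^sup>2 + 1))\<^sup>2
      + ((x\<^sup>2 + y\<^sup>2 - 1) / (x\<^sup>2 + y\<^sup>2 + 1))\<^sup>2) = 1"
    by (simp add: divide_simps) (simp add: power2_eq_square algebra_simps)
  then show ?thesis
    by (simp add: Pair inv_stereographic_def norm_Pair power_divide)
qed

text \<open>The north pole is never reached. This makes every factor \<open>1 - pauli3\<close>
  positive, so the normalization and \<open>K_tilde\<close> involve no division by zero.\<close>

lemma inv_stereographic_third_less_1: "snd (snd (inv_stereographic p)) < 1"
proof (cases p)
  case (Pair x y)
  have "x\<^sup>2 + y\<^sup>2 + 1 > 0"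
    by (simp add: add_nonneg_pos)
  then show ?thesis
    by (simp add: Pair inv_stereographic_def)
qed

lemma norm_diff_unit_sqr:
  fixes u v :: "'a::real_inner"
  assumes "norm u = 1" "norm v = 1"
  shows "(norm (u - v))\<^sup>2 = 2 * (1 - inner u v)"
  using assms by (simp add: power2_norm_eq_inner inner_diff inner_commute norm_eq_1)

text \<open>The 2 in the normalization cancels the 1/2 of the trace distance. Gathering everything
  under one root lets two distances be compared through their radicands.\<close>

lemma normalized_trace_dist_density_pattern:
  fixes p q :: "real \<times> real"
  defines "u \<equiv> inv_stereographic p" and "v \<equiv> inv_stereographic q"
  shows "normalized_trace_dist (density_pattern p) (density_pattern q) =
    sqrt (2 * (1 - inner u v) / ((1 - snd (snd u)) * (1 - snd (snd v))))"
proof -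
  have "norm (u - v) = sqrt (2 * (1 - inner u v))"
    unfolding u_def v_def
    by (metis norm_diff_unit_sqr norm_inv_stereographic norm_ge_zero real_sqrt_unique)
  then show ?thesis
    unfolding normalized_trace_dist_def pauli_components_density_pattern
    unfolding density_pattern_def trace_dist_pauli_matrix
    by (simp add: real_sqrt_divide flip: u_def v_def)
qed

text \<open>The vector form lets \<open>inner\<close> be expanded by bilinearity, without splitting
  into coordinates.\<close>

lemma F_vec_eq:
  "F_vec \<rho> \<sigma> = pauli_components \<rho> - (K_tilde \<rho> \<sigma>)\<^sup>2 *\<^sub>R pauli_components \<sigma>"
  by (simp add: F_vec_def split: prod.splits)

theorem proposition2:
  fixes a b :: "real \<times> real"
  shows "\<forall>c :: real \<times> real.
    normalized_trace_dist (density_pattern c) (density_pattern a)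
      = normalized_trace_dist (density_pattern c) (density_pattern b)
    \<longleftrightarrow> f_QDF (density_pattern a) (density_pattern b) (pauli_components (density_pattern c)) = 0"
proof
  fix c :: "real \<times> real"
  define u v w where "u = inv_stereographic a" and "v = inv_stereographic b"
    and "w = inv_stereographic c"
  define \<alpha> \<beta> \<gamma> where "\<alpha> = 1 - snd (snd u)" and "\<beta> = 1 - snd (snd v)" and "\<gamma> = 1 - snd (snd w)"
  have pos: "\<alpha> > 0" "\<beta> > 0" "\<gamma> > 0"
    using inv_stereographic_third_less_1 by (simp_all add: \<alpha>_def \<beta>_def \<gamma>_def u_def v_def w_def)
  have K: "(K_tilde (density_pattern a) (density_pattern b))\<^sup>2 = \<alpha> / \<beta>"
    using pos by (simp add: K_tilde_def flip: u_def v_def \<alpha>_def \<beta>_def)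
  have "f_QDF (density_pattern a) (density_pattern b) (pauli_components (density_pattern c))
      = inner w u - \<alpha> / \<beta> * inner w v + \<alpha> / \<beta> - 1"
    unfolding f_QDF_def F_vec_eq K pauli_components_density_pattern
    by (simp add: inner_diff_left inner_diff_right inner_commute flip: u_def v_def w_def)
  \<comment> \<open>\<open>sqrt\<close> is injective on the reals, so equal distances mean equal
    radicands.\<close>
  moreover have "normalized_trace_dist (density_pattern c) (density_pattern a)
      = normalized_trace_dist (density_pattern c) (density_pattern b)
    \<longleftrightarrow> 2 * (1 - inner w u) / (\<gamma> * \<alpha>) = 2 * (1 - inner w v) / (\<gamma> * \<beta>)"
    by (simp only: normalized_trace_dist_density_pattern real_sqrt_eq_iff
        flip: u_def v_def w_def \<alpha>_def \<beta>_def \<gamma>_def)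
  moreover have "\<dots> \<longleftrightarrow> inner w u - \<alpha> / \<beta> * inner w v + \<alpha> / \<beta> - 1 = 0"
  proof -
    \<comment> \<open>The common nonzero factor \<open>2 / \<gamma>\<close> is split off and
      cancelled.\<close>
    have "2 * (1 - inner w u) / (\<gamma> * \<alpha>) = 2 * (1 - inner w v) / (\<gamma> * \<beta>)
      \<longleftrightarrow> (1 - inner w u) / \<alpha> = (1 - inner w v) / \<beta>"
      using pos unfolding times_divide_times_eq[symmetric] mult_cancel_left by simp
    \<comment> \<open>Multiplying by \<open>\<alpha>\<close> gives
      \<open>1 - inner w u = \<alpha> / \<beta> * (1 - inner w v)\<close>, which rearranges to the
      affine equation.\<close>
    also have "\<dots> \<longleftrightarrow> inner w u - \<alpha> / \<beta> * inner w v + \<alpha> / \<beta> - 1 = 0"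
      using pos by (simp add: field_simps)
    finally show ?thesis .
  qed
  ultimately show "normalized_trace_dist (density_pattern c) (density_pattern a)
      = normalized_trace_dist (density_pattern c) (density_pattern b)
    \<longleftrightarrow> f_QDF (density_pattern a) (density_pattern b) (pauli_components (density_pattern c)) = 0"
    by simp
qed

end
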